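(* Let $(\mathbb{R}^{3},g_{Sol})$ denote Sol space, where the metric with respect to the standard coordinates $(x,y,z)$ in $\mathbb{R}^{3}$ is given by $g_{Sol}=e^{2z}{\rm d}x^{2}+e^{-2z}{\rm d}y^{2}+{\rm d}z^{2}$. Then: (1) A linear function $f:(\mathbb{R}^{3},g_{Sol})\to\mathbb{R}$, $f(x,y,z)=Ax+By+Cz$, is an $\infty$-harmonic function if and only if $C=0$ or $A=B=0$. (2) A linear map $\varphi:(\mathbb{R}^{3},g_{Sol})\to\mathbb{R}^{n}$ ($n\ge 2$) is $\infty$-harmonic if and only if $\varphi$ is a composition of the projection $\pi_{1}:(\mathbb{R}^{3},g_{Sol})\to\mathbb{R}^{2}$, $\pi_{1}(x,y,z)=(x,y)$, followed by a linear map $\mathbb{R}^{2}\to\mathbb{R}^{n}$, or $\varphi$ is a composition of the projection $\pi_{2}:(\mathbb{R}^{3},g_{Sol})\to\mathbb{R}$, $\pi_{2}(x,y,z)=z$, followed by a linear map $\mathbb{R}\to\mathbb{R}^{n}$.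
   Context: A smooth map $\varphi:(M,g)\to(N,h)$ between Riemannian manifolds is called $\infty$-harmonic if $\tfrac12\,{\rm d}\varphi({\rm grad}\,|{\rm d}\varphi|^2)=0$ on $M$, where $|{\rm d}\varphi|^2={\rm Trace}_g\,\varphi^*h$ is the energy density of $\varphi$ and the gradient is taken with respect to $g$. A function $f:(M,g)\to\mathbb{R}$ is an $\infty$-harmonic function if $\Delta_\infty f=\tfrac12 g(\nabla f,\nabla|\nabla f|^2)=0$, i.e. if it is $\infty$-harmonic as a map into $\mathbb{R}$. Here $A,B,C$ are real constants, and $\mathbb{R}$ and $\mathbb{R}^n$ as targets carry the standard Euclidean metric. *)

theory Defs
  imports "HOL-Analysis.Analysis"
begin

text \<open>
  Riemannian geometry on coordinate spaces: all tangent spaces of a Euclidean space are identified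
  with the space itself, so that \<open>g p u v\<close> is the inner product of the tangent vectors \<open>u\<close> and \<open>v\<close>
  at the point \<open>p\<close>, and the differential of a map is its Frechet derivative.
\<close>

type_synonym 'a metric_tensor = "'a \<Rightarrow> 'a \<Rightarrow> 'a \<Rightarrow> real"

text \<open>
  In finite dimension, \<open>f\<close> is of class \<open>C\<^sup>k\<^sup>+\<^sup>1\<close> iff it is differentiable and all its directional
  derivatives are of class \<open>C\<^sup>k\<close>.
\<close>

primrec Ck :: "nat \<Rightarrow> ('a::euclidean_space \<Rightarrow> 'b::real_normed_vector) \<Rightarrow> bool" where
  "Ck 0 f \<longleftrightarrow> continuous_on UNIV f"
| "Ck (Suc k) f \<longleftrightarrow> (\<forall>p. f differentiable (at p)) \<and> (\<forall>v. Ck k (\<lambda>p. frechet_derivative f (at p) v))"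

definition smooth :: "('a::euclidean_space \<Rightarrow> 'b::real_normed_vector) \<Rightarrow> bool" where
  "smooth f \<longleftrightarrow> (\<forall>k. Ck k f)"

definition riemannian_metric :: "'a::euclidean_space metric_tensor \<Rightarrow> bool" where
  "riemannian_metric g \<longleftrightarrow>
     (\<forall>p. bilinear (g p)) \<and> (\<forall>p u v. g p u v = g p v u) \<and> (\<forall>p v. v \<noteq> 0 \<longrightarrow> g p v v > 0) \<and>
     (\<forall>u v. smooth (\<lambda>p. g p u v))"

definition flat_metric :: "'a::euclidean_space metric_tensor" where
  "flat_metric p u v = u \<bullet> v"

text \<open>The gradient is the vector that represents the differential with respect to \<open>g\<close>.\<close>

definition grad :: "'a::euclidean_space metric_tensor \<Rightarrow> ('a \<Rightarrow> real) \<Rightarrow> 'a \<Rightarrow> 'a" where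
  "grad g f p = (THE v. \<forall>w. g p v w = frechet_derivative f (at p) w)"

definition metric_matrix :: "(real^'m) metric_tensor \<Rightarrow> real^'m \<Rightarrow> real^'m^'m" where
  "metric_matrix g p = (\<chi> i j. g p (axis i 1) (axis j 1))"

text \<open>The trace of a bilinear form \<open>b\<close> at \<open>p\<close> in coordinates: the sum of all \<open>g\<^sup>i\<^sup>j b\<^sub>i\<^sub>j\<close>.\<close>

definition metric_trace :: "(real^'m) metric_tensor \<Rightarrow> real^'m \<Rightarrow> (real^'m \<Rightarrow> real^'m \<Rightarrow> real) \<Rightarrow> real" where
  "metric_trace g p b =
     (\<Sum>i\<in>UNIV. \<Sum>j\<in>UNIV. matrix_inv (metric_matrix g p) $ i $ j * b (axis i 1) (axis j 1))"

definition pullback_metric ::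
    "('a::euclidean_space \<Rightarrow> 'b::euclidean_space) \<Rightarrow> 'b metric_tensor \<Rightarrow> 'a metric_tensor" where
  "pullback_metric \<phi> h p u v =
     h (\<phi> p) (frechet_derivative \<phi> (at p) u) (frechet_derivative \<phi> (at p) v)"

definition energy_density ::
    "(real^'m) metric_tensor \<Rightarrow> 'b::euclidean_space metric_tensor \<Rightarrow> (real^'m \<Rightarrow> 'b) \<Rightarrow> real^'m \<Rightarrow> real" where
  "energy_density g h \<phi> p = metric_trace g p (pullback_metric \<phi> h p)"

definition inf_harmonic_map ::
    "(real^'m) metric_tensor \<Rightarrow> 'b::euclidean_space metric_tensor \<Rightarrow> (real^'m \<Rightarrow> 'b) \<Rightarrow> bool" where
  "inf_harmonic_map g h \<phi> \<longleftrightarrow> smooth \<phi> \<and>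
     (\<forall>p. (1/2) *\<^sub>R frechet_derivative \<phi> (at p) (grad g (energy_density g h \<phi>) p) = 0)"

definition inf_laplacian :: "'a::euclidean_space metric_tensor \<Rightarrow> ('a \<Rightarrow> real) \<Rightarrow> 'a \<Rightarrow> real" where
  "inf_laplacian g f p =
     1/2 * g p (grad g f p) (grad g (\<lambda>q. g q (grad g f q) (grad g f q)) p)"

definition inf_harmonic_function :: "'a::euclidean_space metric_tensor \<Rightarrow> ('a \<Rightarrow> real) \<Rightarrow> bool" where
  "inf_harmonic_function g f \<longleftrightarrow> smooth f \<and> (\<forall>p. inf_laplacian g f p = 0)"

definition sol_metric :: "(real^3) metric_tensor" where
  "sol_metric p u v =
     exp (2 * p$3) * (u$1 * v$1) + exp (- 2 * p$3) * (u$2 * v$2) + u$3 * v$3"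

definition proj_xy :: "real^3 \<Rightarrow> real^2" where
  "proj_xy p = vector [p$1, p$2]"

definition proj_z :: "real^3 \<Rightarrow> real" where
  "proj_z p = p$3"

lemma smooth_const: "smooth (\<lambda>_. c)"
proof -
  have "Ck k (\<lambda>_::'a. c)" for k and c :: 'b
  proof (induction k arbitrary: c)
    case (Suc k)
    have "frechet_derivative (\<lambda>_::'a. c) (at p) = (\<lambda>_. 0)" for p
      by (simp add: frechet_derivative_at[symmetric])
    then show ?case by (simp add: Suc)
  qed simp
  then show ?thesis by (simp add: smooth_def)
qed

lemma riemannian_flat_metric: "riemannian_metric flat_metric"
  by (auto simp: riemannian_metric_def flat_metric_def smooth_const inner_commute bilinear_def
      linear_iff inner_add inner_scaleR_left inner_scaleR_right)

lemma riemannian_sol_metric: "riemannian_metric sol_metric"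
proof -
  have der: "((\<lambda>p. a * exp (2 * p$3) + b * exp (- 2 * p$3) + c) has_derivative
      (\<lambda>v. (2 * a * v$3) * exp (2 * p$3) + (- 2 * b * v$3) * exp (- 2 * p$3) + 0)) (at p)"
    for a b c :: real and p :: "real^3"
    by (auto intro!: derivative_eq_intros bounded_linear.has_derivative[OF bounded_linear_vec_nth]
        simp: algebra_simps)
  have "Ck k (\<lambda>p::real^3. a * exp (2 * p$3) + b * exp (- 2 * p$3) + c)" for k and a b c :: real
  proof (induction k arbitrary: a b c)
    case 0
    show ?case by (auto intro!: continuous_intros)
  next
    case (Suc k)
    show ?case
      unfolding Ck.simps frechet_derivative_at[OF der, symmetric]
      using der Suc by (meson differentiable_def)
  qed
  then have sm: "smooth (\<lambda>p::real^3. a * exp (2 * p$3) + b * exp (- 2 * p$3) + c)" for a b c :: real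
    unfolding smooth_def by blast
  have "smooth (\<lambda>p. sol_metric p u v)" for u v
    using sm[of "u$1 * v$1" "u$2 * v$2" "u$3 * v$3"] by (simp add: sol_metric_def mult.commute)
  moreover have "sol_metric p v v > 0" if "v \<noteq> 0" for p v
  proof -
    have "v$1 \<noteq> 0 \<or> v$2 \<noteq> 0 \<or> v$3 \<noteq> 0"
      using that by (simp add: vec_eq_iff forall_3)
    moreover have "exp (2 * p$3) * (v$1 * v$1) \<ge> 0" "exp (- 2 * p$3) * (v$2 * v$2) \<ge> 0" "v$3 * v$3 \<ge> 0"
      by simp_all
    moreover have "v$1 \<noteq> 0 \<Longrightarrow> exp (2 * p$3) * (v$1 * v$1) > 0"
      "v$2 \<noteq> 0 \<Longrightarrow> exp (- 2 * p$3) * (v$2 * v$2) > 0" "v$3 \<noteq> 0 \<Longrightarrow> v$3 * v$3 > 0"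
      by (simp_all add: zero_less_mult_iff linorder_neq_iff disj_commute)
    ultimately show ?thesis
      unfolding sol_metric_def by linarith
  qed
  moreover have "bilinear (sol_metric p)" for p
    by (auto simp: bilinear_def linear_iff sol_metric_def algebra_simps)
  ultimately show ?thesis
    by (auto simp: riemannian_metric_def sol_metric_def mult.commute)
qed

end

theory Submission
  imports Defs
begin

text \<open>
  The energy density of a linear map with columns \<open>a\<close>, \<open>b\<close>, \<open>c\<close> is
  \<open>e\<^sup>-\<^sup>2\<^sup>z|a|\<^sup>2 + e\<^sup>2\<^sup>z|b|\<^sup>2 + |c|\<^sup>2\<close>, which depends on \<open>z\<close> alone. Its gradient is therefore a multiple
  \<open>s(z) = 2(e\<^sup>2\<^sup>z|b|\<^sup>2 - e\<^sup>-\<^sup>2\<^sup>z|a|\<^sup>2)\<close> of \<open>\<partial>\<^sub>z\<close>, and the map is \<open>\<infinity>\<close>-harmonic iff \<open>s(z) c = 0\<close> for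
  every \<open>z\<close>. The factor \<open>s\<close> vanishes identically only if \<open>a = b = 0\<close>.
\<close>

lemma frechet_derivative_linear:
  fixes f :: "'a::euclidean_space \<Rightarrow> 'b::real_normed_vector"
  assumes "linear f"
  shows "frechet_derivative f (at p) = f"
  using assms
  by (metis frechet_derivative_at linear_conv_bounded_linear bounded_linear_imp_has_derivative)

lemma smooth_linear:
  fixes f :: "'a::euclidean_space \<Rightarrow> 'b::real_normed_vector"
  assumes "linear f"
  shows "smooth f"
proof -
  have bl: "bounded_linear f"
    using assms by (simp add: linear_conv_bounded_linear)
  have "Ck k f" for k
  proof (cases k)
    case 0
    then show ?thesis
      using bl by (simp add: linear_continuous_on)
  next
    case (Suc j)
    then show ?thesis
      using bl smooth_const frechet_derivative_linear[OF assms]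
      by (auto simp: smooth_def intro: bounded_linear_imp_differentiable)
  qed
  then show ?thesis
    by (simp add: smooth_def)
qed

text \<open>Positive definiteness makes the representing vector unique, so exhibiting one candidate
  settles the definite description in \<open>grad\<close>.\<close>

lemma grad_eqI:
  assumes g: "riemannian_metric g"
    and v: "\<And>w. g p v w = frechet_derivative f (at p) w"
  shows "grad g f p = v"
  unfolding grad_def
proof (rule the_equality)
  fix u
  assume u: "\<forall>w. g p u w = frechet_derivative f (at p) w"
  \<comment> \<open>Both candidates represent the same differential; testing it on their own
    difference gives that difference length zero.\<close>
  have "g p (u - v) (u - v) = g p u (u - v) - g p v (u - v)"
    using g by (simp add: riemannian_metric_def bilinear_lsub)
  also have "\<dots> = 0"
    using u v by simp
  finally show "u = v"
    using g by (metis riemannian_metric_def right_minus_eq less_irrefl)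
qed (use v in simp)

lemma grad_sol_linear:
  "grad sol_metric (\<lambda>p. A * p$1 + B * p$2 + C * p$3) p
     = vector [exp (- 2 * p$3) * A, exp (2 * p$3) * B, C]"
proof (rule grad_eqI[OF riemannian_sol_metric])
  have "linear (\<lambda>p::real^3. A * p$1 + B * p$2 + C * p$3)"
    by (auto simp: linear_iff algebra_simps)
  then show "sol_metric p (vector [exp (- 2 * p$3) * A, exp (2 * p$3) * B, C]) w
      = frechet_derivative (\<lambda>p. A * p$1 + B * p$2 + C * p$3) (at p) w" for w
    by (simp add: frechet_derivative_linear sol_metric_def exp_minus field_simps)
qed

text \<open>Both the squared gradient norm of a linear function and the energy density of a linear
  map have this shape. Since the third coordinate direction has unit length and is orthogonal to the
  others, the gradient is the plain z-derivative in that direction.\<close>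

lemma grad_sol_exp:
  "grad sol_metric (\<lambda>p. exp (- 2 * p$3) * a + exp (2 * p$3) * b + c) p
     = (2 * (exp (2 * p$3) * b - exp (- 2 * p$3) * a)) *\<^sub>R axis 3 1"
proof (rule grad_eqI[OF riemannian_sol_metric])
  have "((\<lambda>p::real^3. exp (- 2 * p$3) * a + exp (2 * p$3) * b + c) has_derivative
      (\<lambda>v. 2 * (exp (2 * p$3) * b - exp (- 2 * p$3) * a) * v$3)) (at p)"
    by (auto intro!: derivative_eq_intros bounded_linear.has_derivative[OF bounded_linear_vec_nth]
        simp: algebra_simps)
  then show "sol_metric p ((2 * (exp (2 * p$3) * b - exp (- 2 * p$3) * a)) *\<^sub>R axis 3 1) w
      = frechet_derivative (\<lambda>p. exp (- 2 * p$3) * a + exp (2 * p$3) * b + c) (at p) w" for w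
    by (simp add: frechet_derivative_at[symmetric] sol_metric_def axis_def)
qed

text \<open>This is linear independence of exp(2z) and exp(-2z); the two heights z = 0 and z = 1
  suffice.\<close>

lemma exp_balance_iff:
  fixes a b :: real
  shows "(\<forall>p::real^3. exp (2 * p$3) * b - exp (- 2 * p$3) * a = 0) \<longleftrightarrow> a = 0 \<and> b = 0"
proof
  assume *: "\<forall>p::real^3. exp (2 * p$3) * b - exp (- 2 * p$3) * a = 0"
  have "b = a"
    using *[rule_format, of 0] by simp
  moreover have "(exp 2 - exp (- 2)) * b = 0"
    using *[rule_format, of "vec 1"] \<open>b = a\<close> by (simp add: algebra_simps)
  ultimately show "a = 0 \<and> b = 0"
    by simp
qed simp

text \<open>\<open>matrix_inv\<close> is a choice among two-sided inverses, so it can be computed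
  only once these are known to be unique.\<close>

lemma matrix_inv_unique:
  fixes A :: "'a::semiring_1^'n^'m"
  assumes "A ** B = mat 1" "B ** A = mat 1"
  shows "matrix_inv A = B"
  unfolding matrix_inv_def
proof (rule some_equality)
  show "A ** B = mat 1 \<and> B ** A = mat 1"
    using assms by simp
next
  fix C
  assume "A ** C = mat 1 \<and> C ** A = mat 1"
  then have "C = (C ** A) ** B"
    using assms by (metis matrix_mul_assoc matrix_mul_rid)
  with \<open>A ** C = mat 1 \<and> C ** A = mat 1\<close> show "C = B"
    by (simp add: matrix_mul_lid)
qed

lemma sol_metric_matrix_inv:
  "matrix_inv (metric_matrix sol_metric p)
     = (\<chi> i j. if i = j then vector [exp (- 2 * p$3), exp (2 * p$3), 1] $ i else 0)"
  by (rule matrix_inv_unique)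
    (simp_all add: vec_eq_iff forall_3 matrix_matrix_mult_def mat_def sum_3 metric_matrix_def
      sol_metric_def axis_def exp_minus)

lemma energy_density_sol_linear:
  assumes "linear \<phi>"
  shows "energy_density sol_metric flat_metric \<phi>
    = (\<lambda>p. exp (- 2 * p$3) * (\<phi> (axis 1 1) \<bullet> \<phi> (axis 1 1))
         + exp (2 * p$3) * (\<phi> (axis 2 1) \<bullet> \<phi> (axis 2 1)) + \<phi> (axis 3 1) \<bullet> \<phi> (axis 3 1))"
  by (simp add: fun_eq_iff energy_density_def metric_trace_def sol_metric_matrix_inv sum_3
      pullback_metric_def flat_metric_def frechet_derivative_linear[OF assms])

lemma inf_harmonic_function_sol_linear:
  "inf_harmonic_function sol_metric (\<lambda>p. A * p$1 + B * p$2 + C * p$3)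
     \<longleftrightarrow> C = 0 \<or> (A = 0 \<and> B = 0)"
proof -
  let ?f = "\<lambda>p::real^3. A * p$1 + B * p$2 + C * p$3"
  have "linear ?f"
    by (auto simp: linear_iff algebra_simps)
  then have smooth: "smooth ?f"
    by (rule smooth_linear)
  \<comment> \<open>The metric weight cancels one of the two inverse weights in the squared
    gradient, so \<open>grad_sol_exp\<close> applies with the squared coefficients.\<close>
  have norm_grad: "(\<lambda>q. sol_metric q (grad sol_metric ?f q) (grad sol_metric ?f q))
      = (\<lambda>q. exp (- 2 * q$3) * A\<^sup>2 + exp (2 * q$3) * B\<^sup>2 + C\<^sup>2)"
    unfolding grad_sol_linear
    by (simp add: fun_eq_iff sol_metric_def exp_minus power2_eq_square field_simps)
  have "inf_laplacian sol_metric ?f p = C * (exp (2 * p$3) * B\<^sup>2 - exp (- 2 * p$3) * A\<^sup>2)" for p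
    unfolding inf_laplacian_def norm_grad grad_sol_exp
    unfolding grad_sol_linear
    by (simp add: sol_metric_def axis_def)
  then have "inf_harmonic_function sol_metric ?f
      \<longleftrightarrow> C = 0 \<or> (\<forall>p::real^3. exp (2 * p$3) * B\<^sup>2 - exp (- 2 * p$3) * A\<^sup>2 = 0)"
    using smooth by (auto simp: inf_harmonic_function_def)
  then show ?thesis
    by (simp only: exp_balance_iff zero_eq_power2)
qed

lemma inf_harmonic_map_sol_linear:
  fixes \<phi> :: "real^3 \<Rightarrow> 'b::euclidean_space"
  assumes "linear \<phi>"
  shows "inf_harmonic_map sol_metric flat_metric \<phi>
    \<longleftrightarrow> \<phi> (axis 3 1) = 0 \<or> (\<phi> (axis 1 1) = 0 \<and> \<phi> (axis 2 1) = 0)"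
proof -
  let ?a = "\<phi> (axis 1 1) \<bullet> \<phi> (axis 1 1)" and ?b = "\<phi> (axis 2 1) \<bullet> \<phi> (axis 2 1)"
  have "inf_harmonic_map sol_metric flat_metric \<phi>
      \<longleftrightarrow> (\<forall>p::real^3. (exp (2 * p$3) * ?b - exp (- 2 * p$3) * ?a) *\<^sub>R \<phi> (axis 3 1) = 0)"
    unfolding inf_harmonic_map_def energy_density_sol_linear[OF assms] grad_sol_exp
    by (simp add: smooth_linear assms frechet_derivative_linear linear_cmul)
  \<comment> \<open>The third column is the same at every point, so if it is nonzero the scalar
    factor must vanish everywhere.\<close>
  also have "\<dots> \<longleftrightarrow> \<phi> (axis 3 1) = 0 \<or>
      (\<forall>p::real^3. exp (2 * p$3) * ?b - exp (- 2 * p$3) * ?a = 0)"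
    by auto
  finally show ?thesis
    by (simp only: exp_balance_iff inner_eq_zero_iff)
qed

lemma linear_real3_expansion:
  fixes \<phi> :: "real^3 \<Rightarrow> 'b::real_vector"
  assumes "linear \<phi>"
  shows "\<phi> p = p$1 *\<^sub>R \<phi> (axis 1 1) + p$2 *\<^sub>R \<phi> (axis 2 1) + p$3 *\<^sub>R \<phi> (axis 3 1)"
proof -
  have "p = p$1 *\<^sub>R axis 1 1 + p$2 *\<^sub>R axis 2 1 + p$3 *\<^sub>R axis 3 1"
    by (simp add: vec_eq_iff forall_3 axis_def)
  then have "\<phi> p = \<phi> (p$1 *\<^sub>R axis 1 1 + p$2 *\<^sub>R axis 2 1 + p$3 *\<^sub>R axis 3 1)"
    by (rule arg_cong)
  then show ?thesis
    by (simp only: linear_add[OF assms] linear_cmul[OF assms])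
qed

text \<open>A linear map factors through a surjection exactly when it kills the kernel, here the
  z-axis.\<close>

lemma factors_through_proj_xy_iff:
  fixes \<phi> :: "real^3 \<Rightarrow> 'b::real_vector"
  assumes "linear \<phi>"
  shows "(\<exists>L. linear L \<and> \<phi> = L \<circ> proj_xy) \<longleftrightarrow> \<phi> (axis 3 1) = 0"
proof
  assume "\<exists>L. linear L \<and> \<phi> = L \<circ> proj_xy"
  moreover have "proj_xy (axis 3 1) = 0"
    by (simp add: proj_xy_def vec_eq_iff forall_2 axis_def)
  ultimately show "\<phi> (axis 3 1) = 0"
    by (auto simp: linear_0)
next
  assume 0: "\<phi> (axis 3 1) = 0"
  let ?L = "\<lambda>u::real^2. u$1 *\<^sub>R \<phi> (axis 1 1) + u$2 *\<^sub>R \<phi> (axis 2 1)"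
  have "linear ?L"
    by (auto simp: linear_iff algebra_simps)
  moreover have "\<phi> = ?L \<circ> proj_xy"
  proof
    show "\<phi> p = (?L \<circ> proj_xy) p" for p
      by (subst linear_real3_expansion[OF assms]) (simp add: 0 proj_xy_def)
  qed
  ultimately show "\<exists>L. linear L \<and> \<phi> = L \<circ> proj_xy"
    by blast
qed

text \<open>The same kernel argument applies, with the kernel now spanned by the first two
  axes.\<close>

lemma factors_through_proj_z_iff:
  fixes \<phi> :: "real^3 \<Rightarrow> 'b::real_vector"
  assumes "linear \<phi>"
  shows "(\<exists>L. linear L \<and> \<phi> = L \<circ> proj_z) \<longleftrightarrow> \<phi> (axis 1 1) = 0 \<and> \<phi> (axis 2 1) = 0"
proof
  assume "\<exists>L. linear L \<and> \<phi> = L \<circ> proj_z"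
  moreover have "proj_z (axis 1 1) = 0" "proj_z (axis 2 1) = 0"
    by (simp_all add: proj_z_def axis_def)
  ultimately show "\<phi> (axis 1 1) = 0 \<and> \<phi> (axis 2 1) = 0"
    by (auto simp: linear_0)
next
  assume 0: "\<phi> (axis 1 1) = 0 \<and> \<phi> (axis 2 1) = 0"
  let ?L = "\<lambda>t::real. t *\<^sub>R \<phi> (axis 3 1)"
  have "linear ?L"
    by (auto simp: linear_iff algebra_simps)
  moreover have "\<phi> = ?L \<circ> proj_z"
  proof
    show "\<phi> p = (?L \<circ> proj_z) p" for p
      by (subst linear_real3_expansion[OF assms]) (simp add: 0 proj_z_def)
  qed
  ultimately show "\<exists>L. linear L \<and> \<phi> = L \<circ> proj_z"
    by blast
qed

theorem theorem6p1:
  "(\<forall>A B C :: real.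
      inf_harmonic_function sol_metric (\<lambda>p. A * p$1 + B * p$2 + C * p$3)
        \<longleftrightarrow> C = 0 \<or> (A = 0 \<and> B = 0)) \<and>
   (CARD('n::finite) \<ge> 2 \<longrightarrow>
     (\<forall>\<phi> :: real^3 \<Rightarrow> real^'n. linear \<phi> \<longrightarrow>
       (inf_harmonic_map sol_metric flat_metric \<phi> \<longleftrightarrow>
          (\<exists>L :: real^2 \<Rightarrow> real^'n. linear L \<and> \<phi> = L \<circ> proj_xy) \<or>
          (\<exists>L :: real \<Rightarrow> real^'n. linear L \<and> \<phi> = L \<circ> proj_z))))"
  by (simp add: inf_harmonic_function_sol_linear inf_harmonic_map_sol_linear
      factors_through_proj_xy_iff factors_through_proj_z_iff)

end
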